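(* Let $\mathcal{D}=\{(0,1),(1,1),(-1,0),(1,0),(0,-1)\}$ and let $0<t<1/|\mathcal{D}|$ be transcendental over $\mathbb{Q}$ and such that $G_t$ is infinite. Then for $i=1$ (and for $i=2$) there exist an integer $n\ge0$, $c_0,\dots,c_{n-1}\in\mathbb{C}$ and $g\in\mathbb{C}(\overline{E_t})$ such that $\delta^n(b_i)+c_{n-1}\delta^{n-1}(b_i)+\cdots+c_1\delta(b_i)+c_0b_i=\tau(g)-g$.
   Context: Let $d_{i,j}=1$ if $(i,j)\in\mathcal{D}$, else $0$. $\overline{E_t}\subset\mathbb{P}^1(\mathbb{C})\times\mathbb{P}^1(\mathbb{C})$ is the curve $x_0x_1y_0y_1-t\sum_{i,j=0}^2d_{i-1,j-1}x_0^ix_1^{2-i}y_0^jy_1^{2-j}=0$ (an elliptic curve here), with function field $\mathbb{C}(\overline{E_t})$ and coordinate functions $x=x_0/x_1$, $y=y_0/y_1$. $\iota_1,\iota_2$ are the involutions of $\overline{E_t}$ exchanging the two points of each fibre of the first, resp. second, projection; $\tau=\iota_2\circ\iota_1$; $G_t=\langle\iota_1,\iota_2\rangle$. For $f\in\mathbb{C}(\overline{E_t})$ and an automorphism $\sigma$, $\sigma(f)=f\circ\sigma$. Set $b_1=\iota_1(y)(\tau(x)-x)$ and $b_2=x(\iota_1(y)-y)$. Fix a nonzero regular differential $\Omega$ on $\overline{E_t}$ and let $\delta$ be the derivation with $df=\delta(f)\Omega$. *)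

theory Defs
  imports
    "HOL-Computational_Algebra.Polynomial"
    "HOL-Algebra.AbelCoset"
    "HOL-Algebra.Bij"
    "HOL-Algebra.Generated_Groups"
    "HOL-Algebra.Module"
begin

section \<open>The curve\<close>

quotient_type proj1 = "complex \<times> complex" /
  partial: "\<lambda>u v. u \<noteq> (0, 0) \<and> v \<noteq> (0, 0) \<and> fst u * snd v = snd u * fst v"
proof (rule part_equivpI)
  show "\<exists>u::complex \<times> complex. u \<noteq> (0, 0) \<and> u \<noteq> (0, 0) \<and> fst u * snd u = snd u * fst u"
    by (rule exI[of _ "(1, 0)"]) simp
  show "symp (\<lambda>u v::complex \<times> complex.
      u \<noteq> (0, 0) \<and> v \<noteq> (0, 0) \<and> fst u * snd v = snd u * fst v)"
    by (auto intro!: sympI simp: mult.commute)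
  show "transp (\<lambda>u v::complex \<times> complex.
      u \<noteq> (0, 0) \<and> v \<noteq> (0, 0) \<and> fst u * snd v = snd u * fst v)"
  proof (rule transpI, elim conjE, intro conjI)
    fix u v w :: "complex \<times> complex"
    assume v: "v \<noteq> (0, 0)" and uv: "fst u * snd v = snd u * fst v"
      and vw: "fst v * snd w = snd v * fst w"
    have "fst v * (fst u * snd w) = fst u * (fst v * snd w)"
      by simp
    also have "\<dots> = (fst u * snd v) * fst w"
      by (simp only: vw mult.assoc)
    also have "\<dots> = fst v * (snd u * fst w)"
      by (simp only: uv mult_ac)
    finally have 0: "fst v * (fst u * snd w) = fst v * (snd u * fst w)" .
    have "snd v * (fst u * snd w) = (fst u * snd v) * snd w"
      by simp
    also have "\<dots> = snd u * (fst v * snd w)"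
      by (simp only: uv mult.assoc)
    also have "\<dots> = snd v * (snd u * fst w)"
      by (simp only: vw mult_ac)
    finally have 1: "snd v * (fst u * snd w) = snd v * (snd u * fst w)" .
    from v have "fst v \<noteq> 0 \<or> snd v \<noteq> 0"
      by (simp add: prod_eq_iff)
    with 0 1 show "fst u * snd w = snd u * fst w"
      by (metis mult_left_cancel)
  qed
qed

lemma proj1_rel_scale:
  assumes "u \<noteq> (0, 0) \<and> v \<noteq> (0, 0) \<and> fst u * snd v = snd u * fst (v :: complex \<times> complex)"
  obtains c where "c \<noteq> 0" "fst v = c * fst u" "snd v = c * snd u"
proof (cases "fst u = 0")
  case True
  with assms have "snd u \<noteq> 0" "fst v = 0" "snd v \<noteq> 0"
    by (auto simp: prod_eq_iff)
  with True that[of "snd v / snd u"] show thesis by simp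
next
  case False
  with assms have "fst v \<noteq> 0"
    by (auto simp: prod_eq_iff)
  moreover have "snd v = fst v / fst u * snd u"
    using False assms by (simp add: nonzero_eq_divide_eq mult.commute)
  ultimately show thesis
    using False that[of "fst v / fst u"] by simp
qed

type_synonym point = "proj1 \<times> proj1"

definition bihom ::
  "(nat \<Rightarrow> nat \<Rightarrow> complex) \<Rightarrow> nat \<Rightarrow> nat \<Rightarrow> complex \<times> complex \<Rightarrow> complex \<times> complex \<Rightarrow> complex"
  where "bihom a m n = (\<lambda>(x0, x1) (y0, y1).
     \<Sum>i\<le>m. \<Sum>j\<le>n. a i j * x0 ^ i * x1 ^ (m - i) * y0 ^ j * y1 ^ (n - j))"

lemma bihom_scale:
  assumes "fst u' = c * fst u" "snd u' = c * snd u" "fst v' = d * fst v" "snd v' = d * snd v"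
  shows "bihom a m n u' v' = c ^ m * d ^ n * bihom a m n u v"
proof -
  have pow: "c ^ i * c ^ (k - i) = c ^ k" if "i \<le> k" for c :: complex and i k :: nat
    using that by (simp flip: power_add)
  have "bihom a m n u' v' = (\<Sum>i\<le>m. \<Sum>j\<le>n. (c ^ i * c ^ (m - i)) * (d ^ j * d ^ (n - j)) *
      (a i j * fst u ^ i * snd u ^ (m - i) * fst v ^ j * snd v ^ (n - j)))"
    by (simp add: bihom_def case_prod_beta assms power_mult_distrib mult_ac)
  also have "\<dots> = c ^ m * d ^ n * bihom a m n u v"
    unfolding bihom_def case_prod_beta sum_distrib_left
    by (intro sum.cong refl) (simp add: pow)
  finally show ?thesis .
qed

lift_definition bihom_zero :: "(nat \<Rightarrow> nat \<Rightarrow> complex) \<Rightarrow> nat \<Rightarrow> nat \<Rightarrow> proj1 \<Rightarrow> proj1 \<Rightarrow> bool"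
  is "\<lambda>a m n u v. bihom a m n u v = 0"
proof -
  fix a m n and u u' v v' :: "complex \<times> complex"
  assume "u \<noteq> (0, 0) \<and> u' \<noteq> (0, 0) \<and> fst u * snd u' = snd u * fst u'"
    and "v \<noteq> (0, 0) \<and> v' \<noteq> (0, 0) \<and> fst v * snd v' = snd v * fst v'"
  then obtain c d where "c \<noteq> 0" "fst u' = c * fst u" "snd u' = c * snd u"
    and "d \<noteq> 0" "fst v' = d * fst v" "snd v' = d * snd v"
    by (elim proj1_rel_scale)
  then show "(bihom a m n u v = 0) = (bihom a m n u' v' = 0)"
    using bihom_scale[of u' c u v' d v a m n] by simp
qed

text \<open>The quotient of two forms of the same bidegree; it is junk where the denominator vanishes.\<close>

lift_definition bihom_ratio ::
  "(nat \<Rightarrow> nat \<Rightarrow> complex) \<Rightarrow> (nat \<Rightarrow> nat \<Rightarrow> complex) \<Rightarrow> nat \<Rightarrow> nat \<Rightarrow> proj1 \<Rightarrow> proj1 \<Rightarrow> complex"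
  is "\<lambda>a b m n u v. bihom a m n u v / bihom b m n u v"
proof -
  fix a b m n and u u' v v' :: "complex \<times> complex"
  assume "u \<noteq> (0, 0) \<and> u' \<noteq> (0, 0) \<and> fst u * snd u' = snd u * fst u'"
    and "v \<noteq> (0, 0) \<and> v' \<noteq> (0, 0) \<and> fst v * snd v' = snd v * fst v'"
  then obtain c d where "c \<noteq> 0" "fst u' = c * fst u" "snd u' = c * snd u"
    and "d \<noteq> 0" "fst v' = d * fst v" "snd v' = d * snd v"
    by (elim proj1_rel_scale)
  then show "bihom a m n u v / bihom b m n u v = bihom a m n u' v' / bihom b m n u' v'"
    using bihom_scale[of u' c u v' d v a m n] bihom_scale[of u' c u v' d v b m n] by simp
qed

definition step_weight :: "(int \<times> int) set \<Rightarrow> int \<Rightarrow> int \<Rightarrow> complex"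
  where "step_weight D i j = (if (i, j) \<in> D then 1 else 0)"

lift_definition on_kernel_curve :: "(int \<times> int) set \<Rightarrow> real \<Rightarrow> proj1 \<Rightarrow> proj1 \<Rightarrow> bool"
  is "\<lambda>D t (x0, x1) (y0, y1).
    x0 * x1 * y0 * y1 - complex_of_real t *
      (\<Sum>i=0..2. \<Sum>j=0..2. step_weight D (int i - 1) (int j - 1) *
         x0 ^ i * x1 ^ (2 - i) * y0 ^ j * y1 ^ (2 - j)) = 0"
proof -
  fix D and t :: real and u u' v v' :: "complex \<times> complex"
  assume "u \<noteq> (0, 0) \<and> u' \<noteq> (0, 0) \<and> fst u * snd u' = snd u * fst u'"
    and "v \<noteq> (0, 0) \<and> v' \<noteq> (0, 0) \<and> fst v * snd v' = snd v * fst v'"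
  then obtain c d where c: "c \<noteq> 0" "fst u' = c * fst u" "snd u' = c * snd u"
    and d: "d \<noteq> 0" "fst v' = d * fst v" "snd v' = d * snd v"
    by (elim proj1_rel_scale)
  define B where "B = bihom (\<lambda>i j. step_weight D (int i - 1) (int j - 1)) 2 2"
  have eq: "(case u of (x0, x1) \<Rightarrow> \<lambda>(y0, y1). x0 * x1 * y0 * y1 - complex_of_real t *
      (\<Sum>i=0..2. \<Sum>j=0..2. step_weight D (int i - 1) (int j - 1) *
         x0 ^ i * x1 ^ (2 - i) * y0 ^ j * y1 ^ (2 - j)) = 0) v \<longleftrightarrow>
      fst u * snd u * fst v * snd v - complex_of_real t * B u v = 0" for u v
    by (simp add: B_def bihom_def case_prod_beta atLeast0AtMost)
  have "fst u' * snd u' * fst v' * snd v' - complex_of_real t * B u' v' =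
      c ^ 2 * d ^ 2 * (fst u * snd u * fst v * snd v - complex_of_real t * B u v)"
    unfolding B_def bihom_scale[OF c(2,3) d(2,3)] c(2,3) d(2,3)
    by (simp add: algebra_simps power2_eq_square)
  then show "(case u of (x0, x1) \<Rightarrow> \<lambda>(y0, y1). x0 * x1 * y0 * y1 - complex_of_real t *
      (\<Sum>i=0..2. \<Sum>j=0..2. step_weight D (int i - 1) (int j - 1) *
         x0 ^ i * x1 ^ (2 - i) * y0 ^ j * y1 ^ (2 - j)) = 0) v =
    (case u' of (x0, x1) \<Rightarrow> \<lambda>(y0, y1). x0 * x1 * y0 * y1 - complex_of_real t *
      (\<Sum>i=0..2. \<Sum>j=0..2. step_weight D (int i - 1) (int j - 1) *
         x0 ^ i * x1 ^ (2 - i) * y0 ^ j * y1 ^ (2 - j)) = 0) v'"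
    unfolding eq using c(1) d(1) by simp
qed

definition kernel_curve :: "(int \<times> int) set \<Rightarrow> real \<Rightarrow> point set"
  where "kernel_curve D t = {(p, q). on_kernel_curve D t p q}"

section \<open>The group of the walk\<close>

text \<open>A fibre consists of two points counted with multiplicity: if it is \<open>{q, q'}\<close> with
  \<open>q \<noteq> q'\<close>, the involution exchanges the two, and it fixes the point of a fibre that is a
  singleton. In both cases the image of \<open>q\<close> is the unique \<open>q'\<close> such that the fibre is
  \<open>{q, q'}\<close>. As permutations of the curve the involutions are extensional functions, as
  required by \<^const>\<open>BijGroup\<close>.\<close>

definition iota1 :: "(int \<times> int) set \<Rightarrow> real \<Rightarrow> point \<Rightarrow> point"
  where "iota1 D t = (\<lambda>(p, q) \<in> kernel_curve D t.
     (p, THE q'. {r. (p, r) \<in> kernel_curve D t} = {q, q'}))"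

definition iota2 :: "(int \<times> int) set \<Rightarrow> real \<Rightarrow> point \<Rightarrow> point"
  where "iota2 D t = (\<lambda>(p, q) \<in> kernel_curve D t.
     (THE p'. {r. (r, q) \<in> kernel_curve D t} = {p, p'}, q))"

definition tau :: "(int \<times> int) set \<Rightarrow> real \<Rightarrow> point \<Rightarrow> point"
  where "tau D t = iota2 D t \<circ> iota1 D t"

definition walk_group :: "(int \<times> int) set \<Rightarrow> real \<Rightarrow> (point \<Rightarrow> point) set"
  where "walk_group D t = generate (BijGroup (kernel_curve D t)) {iota1 D t, iota2 D t}"

section \<open>The function field\<close>

text \<open>A rational function on the (irreducible) curve is a function given outside a finite set
  of points by a quotient of two forms of the same bidegree whose denominator does not vanish
  identically on the curve, that is, has only finitely many zeros on it. Two such functions are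
  identified if they agree outside a finite set. The elements of the function field are the
  resulting classes; values at poles and values off the curve are irrelevant.\<close>

definition germ :: "point set \<Rightarrow> (point \<Rightarrow> complex) \<Rightarrow> (point \<Rightarrow> complex) set"
  where "germ E f = {h. finite {P \<in> E. h P \<noteq> f P}}"

definition rational_on :: "point set \<Rightarrow> (point \<Rightarrow> complex) \<Rightarrow> bool"
  where "rational_on E f \<longleftrightarrow> (\<exists>a b m n.
     finite {(p, q) \<in> E. bihom_zero b m n p q} \<and>
     finite {(p, q) \<in> E. f (p, q) \<noteq> bihom_ratio a b m n p q})"

definition function_field :: "point set \<Rightarrow> (point \<Rightarrow> complex) set ring"
  where "function_field E =
    \<lparr>carrier = germ E ` {f. rational_on E f},
     mult = \<lambda>A B. \<Union>f\<in>A. \<Union>g\<in>B. germ E (\<lambda>P. f P * g P),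
     one = germ E (\<lambda>_. 1),
     zero = germ E (\<lambda>_. 0),
     add = \<lambda>A B. \<Union>f\<in>A. \<Union>g\<in>B. germ E (\<lambda>P. f P + g P)\<rparr>"

definition const_fun :: "point set \<Rightarrow> complex \<Rightarrow> (point \<Rightarrow> complex) set"
  where "const_fun E c = germ E (\<lambda>_. c)"

definition local_ring :: "point set \<Rightarrow> point \<Rightarrow> (point \<Rightarrow> complex) set set"
  where "local_ring E P = {germ E (\<lambda>(p, q). bihom_ratio a b m n p q) | a b m n.
     finite {(p, q) \<in> E. bihom_zero b m n p q} \<and> \<not> bihom_zero b m n (fst P) (snd P)}"

text \<open>\<open>pullback E \<sigma> f\<close> is \<open>f \<circ> \<sigma>\<close> for a permutation \<open>\<sigma>\<close> of \<open>E\<close>.\<close>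

definition pullback ::
  "point set \<Rightarrow> (point \<Rightarrow> point) \<Rightarrow> (point \<Rightarrow> complex) set \<Rightarrow> (point \<Rightarrow> complex) set"
  where "pullback E \<sigma> A = (\<Union>f\<in>A. germ E (f \<circ> \<sigma>))"

text \<open>Division by zero makes the affine coordinate \<open>0\<close> at the point at infinity; this affects
  only finitely many points of the curve.\<close>

lift_definition affine_coord :: "proj1 \<Rightarrow> complex" is "\<lambda>(x0, x1). x0 / x1"
  by (erule proj1_rel_scale) (simp add: case_prod_beta)

definition coord_x :: "point set \<Rightarrow> (point \<Rightarrow> complex) set"
  where "coord_x E = germ E (\<lambda>(p, q). affine_coord p)"

definition coord_y :: "point set \<Rightarrow> (point \<Rightarrow> complex) set"
  where "coord_y E = germ E (\<lambda>(p, q). affine_coord q)"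

definition b1 :: "(int \<times> int) set \<Rightarrow> real \<Rightarrow> (point \<Rightarrow> complex) set"
  where "b1 D t = (let E = kernel_curve D t; K = function_field E in
     pullback E (iota1 D t) (coord_y E) \<otimes>\<^bsub>K\<^esub> (pullback E (tau D t) (coord_x E) \<ominus>\<^bsub>K\<^esub> coord_x E))"

definition b2 :: "(int \<times> int) set \<Rightarrow> real \<Rightarrow> (point \<Rightarrow> complex) set"
  where "b2 D t = (let E = kernel_curve D t; K = function_field E in
     coord_x E \<otimes>\<^bsub>K\<^esub> (pullback E (iota1 D t) (coord_y E) \<ominus>\<^bsub>K\<^esub> coord_y E))"

section \<open>Differentials\<close>

definition derivation :: "('a, 'm) ring_scheme \<Rightarrow> 'a set \<Rightarrow> ('a \<Rightarrow> 'a) \<Rightarrow> bool"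
  where "derivation R C \<delta> \<longleftrightarrow> \<delta> \<in> carrier R \<rightarrow> carrier R \<and>
     (\<forall>a\<in>carrier R. \<forall>b\<in>carrier R. \<delta> (a \<oplus>\<^bsub>R\<^esub> b) = \<delta> a \<oplus>\<^bsub>R\<^esub> \<delta> b \<and>
        \<delta> (a \<otimes>\<^bsub>R\<^esub> b) = (a \<otimes>\<^bsub>R\<^esub> \<delta> b) \<oplus>\<^bsub>R\<^esub> (b \<otimes>\<^bsub>R\<^esub> \<delta> a)) \<and>
     (\<forall>c\<in>C. \<delta> c = \<zero>\<^bsub>R\<^esub>)"

text \<open>The free \<open>R\<close>-module on \<open>carrier R\<close>: \<open>w\<close> stands for the formal sum of the \<open>w h\<close> times
  the symbol of \<open>h\<close>. The fields \<open>mult\<close> and \<open>one\<close> of a module record are not used.\<close>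

definition free_module :: "('a, 'm) ring_scheme \<Rightarrow> ('a, 'a \<Rightarrow> 'a) module"
  where "free_module R =
    \<lparr>carrier = {w. range w \<subseteq> carrier R \<and> finite {h. w h \<noteq> \<zero>\<^bsub>R\<^esub>} \<and> {h. w h \<noteq> \<zero>\<^bsub>R\<^esub>} \<subseteq> carrier R},
     mult = undefined, one = undefined,
     zero = \<lambda>_. \<zero>\<^bsub>R\<^esub>,
     add = \<lambda>v w h. v h \<oplus>\<^bsub>R\<^esub> w h,
     smult = \<lambda>a w h. a \<otimes>\<^bsub>R\<^esub> w h\<rparr>"

definition free_gen :: "('a, 'm) ring_scheme \<Rightarrow> 'a \<Rightarrow> 'a \<Rightarrow> 'a"
  where "free_gen R f = (\<lambda>h. if h = f then \<one>\<^bsub>R\<^esub> else \<zero>\<^bsub>R\<^esub>)"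

definition kaehler_relators :: "('a, 'm) ring_scheme \<Rightarrow> 'a set \<Rightarrow> ('a \<Rightarrow> 'a) set"
  where "kaehler_relators R C = (let F = free_module R; s = free_gen R in
     {s (a \<oplus>\<^bsub>R\<^esub> b) \<ominus>\<^bsub>F\<^esub> (s a \<oplus>\<^bsub>F\<^esub> s b) | a b. a \<in> carrier R \<and> b \<in> carrier R} \<union>
     {s (a \<otimes>\<^bsub>R\<^esub> b) \<ominus>\<^bsub>F\<^esub> ((a \<odot>\<^bsub>F\<^esub> s b) \<oplus>\<^bsub>F\<^esub> (b \<odot>\<^bsub>F\<^esub> s a)) | a b. a \<in> carrier R \<and> b \<in> carrier R} \<union>
     s ` C)"

definition kaehler_submodule :: "('a, 'm) ring_scheme \<Rightarrow> 'a set \<Rightarrow> ('a \<Rightarrow> 'a) set"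
  where "kaehler_submodule R C =
     \<Inter> {N. submodule N R (free_module R) \<and> kaehler_relators R C \<subseteq> N}"

text \<open>The module of Kaehler differentials of \<open>R\<close> over \<open>C\<close>, as a module of cosets.\<close>

definition kaehler :: "('a, 'm) ring_scheme \<Rightarrow> 'a set \<Rightarrow> ('a, ('a \<Rightarrow> 'a) set) module"
  where "kaehler R C = (let F = free_module R; N = kaehler_submodule R C in
    \<lparr>carrier = a_rcosets\<^bsub>F\<^esub> N,
     mult = undefined, one = undefined,
     zero = N,
     add = set_add F,
     smult = \<lambda>a W. \<Union>w\<in>W. N +>\<^bsub>F\<^esub> (a \<odot>\<^bsub>F\<^esub> w)\<rparr>)"

definition kaehler_d :: "('a, 'm) ring_scheme \<Rightarrow> 'a set \<Rightarrow> 'a \<Rightarrow> ('a \<Rightarrow> 'a) set"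
  where "kaehler_d R C f = kaehler_submodule R C +>\<^bsub>free_module R\<^esub> free_gen R f"

abbreviation differentials ::
  "point set \<Rightarrow> ((point \<Rightarrow> complex) set,
     ((point \<Rightarrow> complex) set \<Rightarrow> (point \<Rightarrow> complex) set) set) module"
  where "differentials E \<equiv> kaehler (function_field E) (range (const_fun E))"

abbreviation differential ::
  "point set \<Rightarrow> (point \<Rightarrow> complex) set \<Rightarrow>
     ((point \<Rightarrow> complex) set \<Rightarrow> (point \<Rightarrow> complex) set) set"
  where "differential E \<equiv> kaehler_d (function_field E) (range (const_fun E))"

text \<open>A differential is regular if near every point \<open>P\<close> it is a finite sum of terms \<open>f dh\<close>
  with \<open>f\<close> and \<open>h\<close> regular at \<open>P\<close>.\<close>

definition regular_differential ::
  "point set \<Rightarrow> ((point \<Rightarrow> complex) set \<Rightarrow> (point \<Rightarrow> complex) set) set \<Rightarrow> bool"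
  where "regular_differential E \<Omega> \<longleftrightarrow> \<Omega> \<in> carrier (differentials E) \<and>
     (\<forall>P\<in>E. \<exists>S f. finite S \<and> S \<subseteq> local_ring E P \<and> f \<in> S \<rightarrow> local_ring E P \<and>
        \<Omega> = (\<Oplus>\<^bsub>differentials E\<^esub>h\<in>S. f h \<odot>\<^bsub>differentials E\<^esub> differential E h))"

end

theory Submission
  imports Defs
begin

text \<open>Dividing the equation of the curve by \<open>t x y\<close> gives
  \<open>x y = (1/t - x - 1/x) + (- y - 1/y)\<close>. Hence \<open>x y\<close> is the sum of a function
  \<open>F = 1/t - x - 1/x\<close> invariant under \<open>\<iota>\<^sub>1\<close> and a function \<open>G = - y - 1/y\<close> invariant under
  \<open>\<iota>\<^sub>2\<close>. It follows that \<open>b\<^sub>1 = \<tau>(x y) - \<iota>\<^sub>1(x y) = \<tau>(F) - F\<close> and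
  \<open>b\<^sub>2 = \<iota>\<^sub>1(x y) - x y = \<tau>(G) - G\<close>, so that \<open>n = 0\<close> suffices. The constant \<open>1/t\<close> cancels
  in \<open>\<tau>(F) - F\<close> and is left out below.\<close>

section \<open>Germs of functions\<close>

lemma mem_germ_iff: "h \<in> germ E f \<longleftrightarrow> finite {P \<in> E. h P \<noteq> f P}"
  by (simp add: germ_def)

lemma germ_refl [simp]: "f \<in> germ E f"
  by (simp add: mem_germ_iff)

lemma germ_sym: "h \<in> germ E f \<Longrightarrow> f \<in> germ E h"
  by (simp add: mem_germ_iff eq_commute)

lemma germ_trans:
  assumes "f \<in> germ E g" "g \<in> germ E h"
  shows "f \<in> germ E h"
  using assms unfolding mem_germ_iff
  by (rule finite_subset[OF _ finite_UnI, rotated]) auto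

lemma germ_eq_iff: "germ E f = germ E g \<longleftrightarrow> f \<in> germ E g"
  by (metis germ_refl germ_sym germ_trans subsetI subset_antisym)

lemma germ_eqI:
  assumes "finite S" "\<And>P. P \<in> E \<Longrightarrow> P \<notin> S \<Longrightarrow> f P = g P"
  shows "germ E f = germ E g"
  unfolding germ_eq_iff mem_germ_iff
  by (rule finite_subset[OF _ assms(1)]) (use assms(2) in auto)

text \<open>Changing representatives alters values only on the union of two finite sets. Hence the
  unions over all representatives that define the field operations are unions of a single
  germ.\<close>

lemma germ_comp2:
  assumes "f' \<in> germ E f" "g' \<in> germ E g"
  shows "germ E (\<lambda>P. F (f' P) (g' P)) = germ E (\<lambda>P. F (f P) (g P))"
proof (rule germ_eqI)
  show "finite ({P \<in> E. f' P \<noteq> f P} \<union> {P \<in> E. g' P \<noteq> g P})"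
    using assms by (simp add: mem_germ_iff)
qed auto

lemma germ_mult: "germ E f \<otimes>\<^bsub>function_field E\<^esub> germ E g = germ E (\<lambda>P. f P * g P)"
proof -
  have "(\<Union>f'\<in>germ E f. \<Union>g'\<in>germ E g. germ E (\<lambda>P. f' P * g' P)) =
      (\<Union>f'\<in>germ E f. \<Union>g'\<in>germ E g. germ E (\<lambda>P. f P * g P))"
    by (intro SUP_cong refl germ_comp2)
  \<comment> \<open>The union is now over a constant set, so only nonemptiness of the index sets
    matters, and \<open>germ_refl\<close> provides it.\<close>
  also have "\<dots> = germ E (\<lambda>P. f P * g P)"
    using germ_refl by blast
  finally show ?thesis
    by (simp add: function_field_def)
qed

lemma germ_add: "germ E f \<oplus>\<^bsub>function_field E\<^esub> germ E g = germ E (\<lambda>P. f P + g P)"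
proof -
  have "(\<Union>f'\<in>germ E f. \<Union>g'\<in>germ E g. germ E (\<lambda>P. f' P + g' P)) =
      (\<Union>f'\<in>germ E f. \<Union>g'\<in>germ E g. germ E (\<lambda>P. f P + g P))"
    by (intro SUP_cong refl germ_comp2)
  also have "\<dots> = germ E (\<lambda>P. f P + g P)"
    using germ_refl by blast
  finally show ?thesis
    by (simp add: function_field_def)
qed

lemma bihom_ratio_uminus: "bihom_ratio (\<lambda>i j. - a i j) b m n p q = - bihom_ratio a b m n p q"
  by transfer (simp add: bihom_def case_prod_beta sum_negf)

lemma rational_on_uminus:
  assumes "rational_on E f"
  shows "rational_on E (\<lambda>P. - f P)"
proof -
  obtain a b m n where "finite {(p, q) \<in> E. bihom_zero b m n p q}"
    and "finite {(p, q) \<in> E. f (p, q) \<noteq> bihom_ratio a b m n p q}"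
    using assms unfolding rational_on_def by blast
  then show ?thesis
    unfolding rational_on_def
    by (intro exI[of _ "\<lambda>i j. - a i j"] exI[of _ b] exI[of _ m] exI[of _ n])
       (simp add: bihom_ratio_uminus)
qed

lemma germ_in_function_field: "rational_on E f \<Longrightarrow> germ E f \<in> carrier (function_field E)"
  by (simp add: function_field_def)

text \<open>The additive inverse is a definite description over the carrier and is evaluated
  directly, without the ring axioms for \<open>function_field\<close>. Rationality puts the
  candidate into the carrier; it is unique because \<open>f + h = 0\<close> off a finite set
  determines the germ of \<open>h\<close>.\<close>

lemma germ_a_inv:
  assumes "rational_on E f"
  shows "\<ominus>\<^bsub>function_field E\<^esub> germ E f = germ E (\<lambda>P. - f P)"
proof -
  let ?K = "function_field E"
  have zero: "\<zero>\<^bsub>?K\<^esub> = germ E (\<lambda>_. 0)"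
    by (simp add: function_field_def)
  have "(THE A. A \<in> carrier ?K \<and> germ E f \<oplus>\<^bsub>?K\<^esub> A = \<zero>\<^bsub>?K\<^esub> \<and> A \<oplus>\<^bsub>?K\<^esub> germ E f = \<zero>\<^bsub>?K\<^esub>) =
      germ E (\<lambda>P. - f P)"
  proof (rule the_equality)
    show "germ E (\<lambda>P. - f P) \<in> carrier ?K \<and>
        germ E f \<oplus>\<^bsub>?K\<^esub> germ E (\<lambda>P. - f P) = \<zero>\<^bsub>?K\<^esub> \<and>
        germ E (\<lambda>P. - f P) \<oplus>\<^bsub>?K\<^esub> germ E f = \<zero>\<^bsub>?K\<^esub>"
      using assms by (simp add: germ_add zero germ_in_function_field rational_on_uminus)
  next
    fix A
    assume A: "A \<in> carrier ?K \<and> germ E f \<oplus>\<^bsub>?K\<^esub> A = \<zero>\<^bsub>?K\<^esub> \<and> A \<oplus>\<^bsub>?K\<^esub> germ E f = \<zero>\<^bsub>?K\<^esub>"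
    then obtain h where h: "A = germ E h"
      by (auto simp: function_field_def)
    have "finite {P \<in> E. f P + h P \<noteq> 0}"
      using A by (simp add: h germ_add zero germ_eq_iff mem_germ_iff)
    then show "A = germ E (\<lambda>P. - f P)"
      by (simp add: h germ_eq_iff mem_germ_iff eq_neg_iff_add_eq_0 add.commute)
  qed
  then show ?thesis
    by (simp add: a_inv_def m_inv_def)
qed

lemma germ_minus:
  assumes "rational_on E g"
  shows "germ E f \<ominus>\<^bsub>function_field E\<^esub> germ E g = germ E (\<lambda>P. f P - g P)"
  by (simp add: a_minus_def germ_a_inv[OF assms] germ_add)

text \<open>Another representative of the germ changes the composite only on the preimage of a
  finite set. Finiteness of such preimages is therefore what makes composition with \<sigma> well
  defined on germs.\<close>

lemma pullback_germ:
  assumes \<sigma>: "\<And>P. P \<in> E \<Longrightarrow> \<sigma> P \<in> E"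
    and fin: "\<And>S. finite S \<Longrightarrow> finite {P \<in> E. \<sigma> P \<in> S}"
  shows "pullback E \<sigma> (germ E f) = germ E (f \<circ> \<sigma>)"
proof -
  have "germ E (f' \<circ> \<sigma>) = germ E (f \<circ> \<sigma>)" if "f' \<in> germ E f" for f'
  proof (rule germ_eqI)
    show "finite {P \<in> E. \<sigma> P \<in> {Q \<in> E. f' Q \<noteq> f Q}}"
      using that by (intro fin) (simp add: mem_germ_iff)
  qed (use \<sigma> in auto)
  then show ?thesis
    unfolding pullback_def using germ_refl by blast
qed

section \<open>Points of the projective line\<close>

lemma proj1_cases:
  obtains x0 x1 where "(x0, x1) \<noteq> (0, 0)" "p = abs_proj1 (x0, x1)"
proof -
  define u where "u = rep_proj1 p"
  \<comment> \<open>The quotient is partial: a representative is related to itself, and this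
    excludes the pair of zeros.\<close>
  have u: "u \<noteq> (0, 0)" "p = abs_proj1 u"
    using Quotient3_rep_reflp[OF Quotient3_proj1, of p] Quotient3_abs_rep[OF Quotient3_proj1, of p]
    by (simp_all add: u_def)
  then show thesis
    using that[of "fst u" "snd u"] by simp
qed

lemma abs_proj1_eq_iff:
  assumes "(x0, x1) \<noteq> (0, 0)" "(y0, y1) \<noteq> (0, 0)"
  shows "abs_proj1 (x0, x1) = abs_proj1 (y0, y1) \<longleftrightarrow> x0 * y1 = x1 * y0"
  using Quotient3_rel[OF Quotient3_proj1, of "(x0, x1)" "(y0, y1)"] assms by auto

lemma affine_coord_abs:
  assumes "(x0, x1) \<noteq> (0, 0)"
  shows "affine_coord (abs_proj1 (x0, x1)) = x0 / x1"
  using assms by (subst affine_coord.abs_eq) (auto simp: mult.commute)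

text \<open>Because of the junk value at infinity, both \<open>0\<close> and \<open>\<infinity>\<close> have affine coordinate \<open>0\<close>.\<close>

lemma finite_affine_coord_eq_0: "finite {p. affine_coord p = 0}"
proof (rule finite_subset)
  show "{p. affine_coord p = 0} \<subseteq> {abs_proj1 (0, 1), abs_proj1 (1, 0)}"
  proof
    fix p assume "p \<in> {p. affine_coord p = 0}"
    then show "p \<in> {abs_proj1 (0, 1), abs_proj1 (1, 0)}"
      by (cases p rule: proj1_cases) (auto simp: affine_coord_abs abs_proj1_eq_iff)
  qed
qed simp

lemma bihom_zero_abs:
  assumes "(x0, x1) \<noteq> (0, 0)" "(y0, y1) \<noteq> (0, 0)"
  shows "bihom_zero a m n (abs_proj1 (x0, x1)) (abs_proj1 (y0, y1)) \<longleftrightarrow>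
    bihom a m n (x0, x1) (y0, y1) = 0"
  using assms by (subst bihom_zero.abs_eq) (auto simp: mult.commute)

lemma bihom_ratio_abs:
  assumes "(x0, x1) \<noteq> (0, 0)" "(y0, y1) \<noteq> (0, 0)"
  shows "bihom_ratio a b m n (abs_proj1 (x0, x1)) (abs_proj1 (y0, y1)) =
    bihom a m n (x0, x1) (y0, y1) / bihom b m n (x0, x1) (y0, y1)"
  using assms by (subst bihom_ratio.abs_eq) (auto simp: mult.commute)

text \<open>A binary quadratic form with a known zero \<open>(r0 : r1)\<close> splits off the
  corresponding linear factor. The other factor gives the second zero \<open>(s0 : s1)\<close>,
  found without square roots; it is a genuine point because the form is not identically
  zero.\<close>

lemma quadratic_form_zeros:
  fixes A B C :: complex
  assumes nz: "(A, B, C) \<noteq> (0, 0, 0)" and r: "(r0, r1) \<noteq> (0, 0)"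
    and root: "A * r0\<^sup>2 + B * r0 * r1 + C * r1\<^sup>2 = 0"
  obtains s0 s1 where "(s0, s1) \<noteq> (0, 0)"
    "\<And>y0 y1. A * y0\<^sup>2 + B * y0 * y1 + C * y1\<^sup>2 = 0 \<longleftrightarrow> y0 * r1 = y1 * r0 \<or> y0 * s1 = y1 * s0"
proof -
  have "\<exists>s0 s1. A = r1 * s1 \<and> B = - (r1 * s0 + r0 * s1) \<and> C = r0 * s0"
  proof (cases "r1 = 0")
    case True
    with r root have "r0 \<noteq> 0" "A = 0" by auto
    with True show ?thesis
      by (intro exI[of _ "C / r0"] exI[of _ "- B / r0"]) auto
  next
    case False
    show ?thesis
    proof (intro exI conjI)
      \<comment> \<open>Comparing the coefficients \<open>A\<close> and \<open>B\<close> fixes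
        \<open>s1\<close> and then \<open>s0\<close>; the remaining identity for \<open>C\<close> is
        the root equation.\<close>
      show "A = r1 * (A / r1)" and "B = - (r1 * (- (B + r0 * (A / r1)) / r1) + r0 * (A / r1))"
        using False by (auto simp: field_simps)
      have "C * r1\<^sup>2 = - r0 * (B * r1 + A * r0)"
        using root by (simp add: algebra_simps power2_eq_square add_eq_0_iff)
      then show "C = r0 * (- (B + r0 * (A / r1)) / r1)"
        using False by (simp add: field_simps power2_eq_square)
    qed
  qed
  then obtain s0 s1 where s: "A = r1 * s1" "B = - (r1 * s0 + r0 * s1)" "C = r0 * s0"
    by blast
  show thesis
  proof (rule that)
    show "(s0, s1) \<noteq> (0, 0)"
      using nz s by auto
    fix y0 y1
    have "A * y0\<^sup>2 + B * y0 * y1 + C * y1\<^sup>2 = (y0 * r1 - y1 * r0) * (y0 * s1 - y1 * s0)"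
      unfolding s by (simp add: algebra_simps power2_eq_square)
    then show "A * y0\<^sup>2 + B * y0 * y1 + C * y1\<^sup>2 = 0 \<longleftrightarrow> y0 * r1 = y1 * r0 \<or> y0 * s1 = y1 * s0"
      by simp
  qed
qed

section \<open>The curve and its involutions\<close>

definition steps :: "(int \<times> int) set"
  where "steps = {(0, 1), (1, 1), (-1, 0), (1, 0), (0, -1)}"

text \<open>The equation is grouped as a binary quadratic form in \<open>(y0, y1)\<close>, the shape
  to which \<open>quadratic_form_zeros\<close> applies.\<close>

lemma on_kernel_curve_abs:
  assumes "(x0, x1) \<noteq> (0, 0)" "(y0, y1) \<noteq> (0, 0)"
  shows "on_kernel_curve steps t (abs_proj1 (x0, x1)) (abs_proj1 (y0, y1)) \<longleftrightarrow>
    - (t * (x0 * x1 + x0\<^sup>2)) * y0\<^sup>2 + (x0 * x1 - t * (x0\<^sup>2 + x1\<^sup>2)) * y0 * y1 +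
      - (t * x0 * x1) * y1\<^sup>2 = 0" (is "_ \<longleftrightarrow> ?R = 0")
proof -
  have w: "step_weight steps (-1) (-1) = 0" "step_weight steps (-1) 0 = 1"
    "step_weight steps (-1) 1 = 0" "step_weight steps 0 (-1) = 1"
    "step_weight steps 0 0 = 0" "step_weight steps 0 1 = 1"
    "step_weight steps 1 (-1) = 0" "step_weight steps 1 0 = 1"
    "step_weight steps 1 1 = 1"
    by (simp_all add: step_weight_def steps_def)
  have set: "{0..2::nat} = {0, 1, 2}"
    by auto
  have "x0 * x1 * y0 * y1 - complex_of_real t *
      (\<Sum>i=0..2. \<Sum>j=0..2. step_weight steps (int i - 1) (int j - 1) *
         x0 ^ i * x1 ^ (2 - i) * y0 ^ j * y1 ^ (2 - j)) = ?R"
    unfolding set by (simp add: w algebra_simps power2_eq_square)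
  then show ?thesis
    using assms by (subst on_kernel_curve.abs_eq) (auto simp: mult.commute)
qed

text \<open>The step set is invariant under swapping coordinates. This transfers results on the
  fibres of the first projection to the second.\<close>

lemma on_kernel_curve_sym: "on_kernel_curve steps t p q \<longleftrightarrow> on_kernel_curve steps t q p"
proof -
  obtain x0 x1 y0 y1 where "(x0, x1) \<noteq> (0, 0)" "p = abs_proj1 (x0, x1)"
    "(y0, y1) \<noteq> (0, 0)" "q = abs_proj1 (y0, y1)"
    by (metis proj1_cases)
  then show ?thesis
    by (simp add: on_kernel_curve_abs algebra_simps power2_eq_square)
qed

lemma on_kernel_curve_affine:
  assumes "t \<noteq> 0" "on_kernel_curve steps t p q" "affine_coord p \<noteq> 0" "affine_coord q \<noteq> 0"
  shows "affine_coord p * affine_coord q = 1 / complex_of_real t -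
    (affine_coord p + 1 / affine_coord p) - (affine_coord q + 1 / affine_coord q)"
proof -
  obtain x0 x1 y0 y1 where p: "(x0, x1) \<noteq> (0, 0)" "p = abs_proj1 (x0, x1)"
    and q: "(y0, y1) \<noteq> (0, 0)" "q = abs_proj1 (y0, y1)"
    by (metis proj1_cases)
  \<comment> \<open>Since division by zero yields 0, a nonzero affine coordinate excludes both 0 and
    infinity.\<close>
  then have nz: "x0 \<noteq> 0" "x1 \<noteq> 0" "y0 \<noteq> 0" "y1 \<noteq> 0" "complex_of_real t \<noteq> 0"
    using assms by (auto simp: affine_coord_abs)
  have eq: "- (t * (x0 * x1 + x0\<^sup>2)) * y0\<^sup>2 + (x0 * x1 - t * (x0\<^sup>2 + x1\<^sup>2)) * y0 * y1 +
      - (t * x0 * x1) * y1\<^sup>2 = 0"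
    using assms(2) on_kernel_curve_abs[OF p(1) q(1)] p q by simp
  have "x0 / x1 * (y0 / y1) -
      (1 / complex_of_real t - (x0 / x1 + 1 / (x0 / x1)) - (y0 / y1 + 1 / (y0 / y1))) =
    - (- (t * (x0 * x1 + x0\<^sup>2)) * y0\<^sup>2 + (x0 * x1 - t * (x0\<^sup>2 + x1\<^sup>2)) * y0 * y1 +
      - (t * x0 * x1) * y1\<^sup>2) / (t * x0 * x1 * y0 * y1)"
    using nz by (simp add: divide_simps) (simp add: algebra_simps power2_eq_square)
  then show ?thesis
    using p q unfolding eq by (simp add: affine_coord_abs)
qed

section \<open>Fibres of the two projections\<close>

lemma kernel_curve_fibre_fst:
  assumes "t \<noteq> 0"
  shows "finite {r. on_kernel_curve steps t p r}"
    and "on_kernel_curve steps t p q \<Longrightarrow> \<exists>q'. {r. on_kernel_curve steps t p r} = {q, q'}"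
proof -
  obtain x0 x1 where x: "(x0, x1) \<noteq> (0, 0)" "p = abs_proj1 (x0, x1)"
    by (rule proj1_cases)
  \<comment> \<open>No fibre is a whole projective line: a vanishing last coefficient gives
    \<open>x0 * x1 = 0\<close>, and then a vanishing middle one gives
    \<open>x0 = x1 = 0\<close>.\<close>
  have "(- (t * (x0 * x1 + x0\<^sup>2)), x0 * x1 - t * (x0\<^sup>2 + x1\<^sup>2), - (t * x0 * x1)) \<noteq> (0, 0, 0)"
    using assms x(1) by (auto simp: power2_eq_square)
  note zeros = quadratic_form_zeros[OF this]
  show fib: "\<exists>q'. {r. on_kernel_curve steps t p r} = {q, q'}" if q: "on_kernel_curve steps t p q" for q
  proof -
    obtain y0 y1 where y: "(y0, y1) \<noteq> (0, 0)" "q = abs_proj1 (y0, y1)"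
      by (rule proj1_cases)
    obtain s0 s1 where s: "(s0, s1) \<noteq> (0, 0)"
      and iff: "\<And>z0 z1. - (t * (x0 * x1 + x0\<^sup>2)) * z0\<^sup>2 + (x0 * x1 - t * (x0\<^sup>2 + x1\<^sup>2)) * z0 * z1 +
        - (t * x0 * x1) * z1\<^sup>2 = 0 \<longleftrightarrow> z0 * y1 = z1 * y0 \<or> z0 * s1 = z1 * s0"
      using zeros[OF y(1)] q on_kernel_curve_abs[OF x(1) y(1)] x(2) y(2) by metis
    have "on_kernel_curve steps t p r \<longleftrightarrow> r = q \<or> r = abs_proj1 (s0, s1)" for r
    proof -
      obtain z0 z1 where z: "(z0, z1) \<noteq> (0, 0)" "r = abs_proj1 (z0, z1)"
        by (rule proj1_cases)
      show ?thesis
        unfolding x(2) y(2) z(2) on_kernel_curve_abs[OF x(1) z(1)]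
          abs_proj1_eq_iff[OF z(1) y(1)] abs_proj1_eq_iff[OF z(1) s] by (rule iff)
    qed
    then show ?thesis
      by (intro exI[of _ "abs_proj1 (s0, s1)"]) auto
  qed
  show "finite {r. on_kernel_curve steps t p r}"
  \<comment> \<open>The description as a pair starts from a known point; an empty fibre is trivially
    finite.\<close>
  proof (cases "\<exists>q. on_kernel_curve steps t p q")
    case True
    then obtain q q' where "{r. on_kernel_curve steps t p r} = {q, q'}"
      using fib by blast
    then show ?thesis by simp
  qed simp
qed

lemma kernel_curve_fibre_snd:
  assumes "t \<noteq> 0"
  shows "finite {r. on_kernel_curve steps t r q}"
    and "on_kernel_curve steps t p q \<Longrightarrow> \<exists>p'. {r. on_kernel_curve steps t r q} = {p, p'}"
  using kernel_curve_fibre_fst[OF assms] by (simp_all add: on_kernel_curve_sym[of t _ q])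

lemma finite_kernel_curve_fst:
  assumes "t \<noteq> 0" "finite S"
  shows "finite {P \<in> kernel_curve steps t. fst P \<in> S}"
proof (rule finite_subset)
  show "{P \<in> kernel_curve steps t. fst P \<in> S} \<subseteq> (SIGMA p:S. {q. on_kernel_curve steps t p q})"
    by (auto simp: kernel_curve_def)
qed (use assms kernel_curve_fibre_fst in auto)

lemma finite_kernel_curve_snd:
  assumes "t \<noteq> 0" "finite S"
  shows "finite {P \<in> kernel_curve steps t. snd P \<in> S}"
proof (rule finite_subset)
  show "{P \<in> kernel_curve steps t. snd P \<in> S} \<subseteq>
      prod.swap ` (SIGMA q:S. {p. on_kernel_curve steps t p q})"
    by (force simp: kernel_curve_def)
qed (use assms kernel_curve_fibre_snd in auto)

section \<open>The involutions and pullback along them\<close>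

lemma iota1:
  assumes "t \<noteq> 0" "P \<in> kernel_curve steps t"
  shows "iota1 steps t P \<in> kernel_curve steps t" "fst (iota1 steps t P) = fst P"
proof -
  obtain p q where P: "P = (p, q)"
    by (cases P)
  with assms obtain q' where q': "{r. on_kernel_curve steps t p r} = {q, q'}"
    using kernel_curve_fibre_fst(2)[of t p q] by (auto simp: kernel_curve_def)
  \<comment> \<open>The partner of \<open>q\<close> in its fibre is unique even at a double point,
    where \<open>q' = q\<close>.\<close>
  have "(THE r'. {r. (p, r) \<in> kernel_curve steps t} = {q, r'}) = q'"
    by (rule the_equality) (use q' in \<open>auto simp: kernel_curve_def doubleton_eq_iff\<close>)
  then have "iota1 steps t P = (p, q')"
    using assms(2) by (simp add: iota1_def P)
  with q' P show "iota1 steps t P \<in> kernel_curve steps t" "fst (iota1 steps t P) = fst P"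
    by (auto simp: kernel_curve_def)
qed

lemma iota2:
  assumes "t \<noteq> 0" "P \<in> kernel_curve steps t"
  shows "iota2 steps t P \<in> kernel_curve steps t" "snd (iota2 steps t P) = snd P"
proof -
  obtain p q where P: "P = (p, q)"
    by (cases P)
  with assms obtain p' where p': "{r. on_kernel_curve steps t r q} = {p, p'}"
    using kernel_curve_fibre_snd(2)[of t p q] by (auto simp: kernel_curve_def)
  have "(THE r'. {r. (r, q) \<in> kernel_curve steps t} = {p, r'}) = p'"
    by (rule the_equality) (use p' in \<open>auto simp: kernel_curve_def doubleton_eq_iff\<close>)
  then have "iota2 steps t P = (p', q)"
    using assms(2) by (simp add: iota2_def P)
  with p' P show "iota2 steps t P \<in> kernel_curve steps t" "snd (iota2 steps t P) = snd P"
    by (auto simp: kernel_curve_def)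
qed

lemma tau:
  assumes "t \<noteq> 0" "P \<in> kernel_curve steps t"
  shows "tau steps t P \<in> kernel_curve steps t" "snd (tau steps t P) = snd (iota1 steps t P)"
  using iota1[OF assms] iota2[OF assms(1)] by (simp_all add: tau_def)

lemma finite_vimage_iota1:
  assumes "t \<noteq> 0" "finite S"
  shows "finite {P \<in> kernel_curve steps t. iota1 steps t P \<in> S}"
proof (rule finite_subset)
  show "{P \<in> kernel_curve steps t. iota1 steps t P \<in> S} \<subseteq>
      {P \<in> kernel_curve steps t. fst P \<in> fst ` S}"
    using iota1(2)[OF assms(1)] by (auto intro!: rev_image_eqI)
qed (use assms finite_kernel_curve_fst in auto)

lemma finite_vimage_iota2:
  assumes "t \<noteq> 0" "finite S"
  shows "finite {P \<in> kernel_curve steps t. iota2 steps t P \<in> S}"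
proof (rule finite_subset)
  show "{P \<in> kernel_curve steps t. iota2 steps t P \<in> S} \<subseteq>
      {P \<in> kernel_curve steps t. snd P \<in> snd ` S}"
    using iota2(2)[OF assms(1)] by (auto intro!: rev_image_eqI)
qed (use assms finite_kernel_curve_snd in auto)

lemma finite_vimage_tau:
  assumes "t \<noteq> 0" "finite S"
  shows "finite {P \<in> kernel_curve steps t. tau steps t P \<in> S}"
proof -
  have "{P \<in> kernel_curve steps t. tau steps t P \<in> S} =
      {P \<in> kernel_curve steps t. iota1 steps t P \<in> {Q \<in> kernel_curve steps t. iota2 steps t Q \<in> S}}"
    using iota1(1)[OF assms(1)] by (auto simp: tau_def)
  then show ?thesis
    using finite_vimage_iota1[OF assms(1) finite_vimage_iota2[OF assms]] by simp
qed

lemma pullback_iota1: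
  assumes "t \<noteq> 0"
  shows "pullback (kernel_curve steps t) (iota1 steps t) (germ (kernel_curve steps t) f) =
    germ (kernel_curve steps t) (f \<circ> iota1 steps t)"
  by (rule pullback_germ[OF iota1(1)[OF assms] finite_vimage_iota1[OF assms]])

lemma pullback_tau:
  assumes "t \<noteq> 0"
  shows "pullback (kernel_curve steps t) (tau steps t) (germ (kernel_curve steps t) f) =
    germ (kernel_curve steps t) (f \<circ> tau steps t)"
  by (rule pullback_germ[OF tau(1)[OF assms] finite_vimage_tau[OF assms]])

section \<open>Rationality of the functions involved\<close>

lemma rational_on_kernel_curve:
  assumes "t \<noteq> 0"
    and zero: "\<And>p q. bihom_zero b m n p q \<Longrightarrow> affine_coord p = 0 \<or> affine_coord q = 0"
    and ratio: "\<And>p q. f (p, q) = bihom_ratio a b m n p q"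
  shows "rational_on (kernel_curve steps t) f"
  unfolding rational_on_def
proof (rule exI[of _ a], rule exI[of _ b], rule exI[of _ m], rule exI[of _ n], rule conjI)
  let ?Z = "{p. affine_coord p = 0}"
  show "finite {(p, q) \<in> kernel_curve steps t. bihom_zero b m n p q}"
  proof (rule finite_subset)
    \<comment> \<open>The denominator vanishes only over 0 or infinity in one of the factors, and
      the curve has finitely many points there.\<close>
    show "{(p, q) \<in> kernel_curve steps t. bihom_zero b m n p q} \<subseteq>
        {P \<in> kernel_curve steps t. fst P \<in> ?Z} \<union> {P \<in> kernel_curve steps t. snd P \<in> ?Z}"
      by (auto dest: zero)
  qed (simp add: finite_kernel_curve_fst finite_kernel_curve_snd finite_affine_coord_eq_0 assms(1)
      del: mem_Collect_eq)
qed (simp add: ratio)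

lemma rational_on_coord_x:
  assumes "t \<noteq> 0"
  shows "rational_on (kernel_curve steps t) (\<lambda>(p, q). affine_coord p)"
proof (rule rational_on_kernel_curve[OF assms])
  fix p q
  obtain x0 x1 y0 y1 where pq: "(x0, x1) \<noteq> (0, 0)" "p = abs_proj1 (x0, x1)"
    "(y0, y1) \<noteq> (0, 0)" "q = abs_proj1 (y0, y1)"
    by (metis proj1_cases)
  \<comment> \<open>In bidegree (1, 0) the indicator of \<open>i = 0\<close> is the form
    \<open>x1\<close>, and the indicator of \<open>i = 1\<close> is the form
    \<open>x0\<close>.\<close>
  show "affine_coord p = 0 \<or> affine_coord q = 0"
    if "bihom_zero (\<lambda>i j. of_bool (i = 0)) 1 0 p q"
    using that pq by (auto simp: bihom_zero_abs affine_coord_abs bihom_def)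
  show "(case (p, q) of (p, q) \<Rightarrow> affine_coord p) =
      bihom_ratio (\<lambda>i j. of_bool (i = 1)) (\<lambda>i j. of_bool (i = 0)) 1 0 p q"
    using pq by (simp add: bihom_ratio_abs affine_coord_abs bihom_def)
qed

lemma rational_on_coord_y:
  assumes "t \<noteq> 0"
  shows "rational_on (kernel_curve steps t) (\<lambda>(p, q). affine_coord q)"
proof (rule rational_on_kernel_curve[OF assms])
  fix p q
  obtain x0 x1 y0 y1 where pq: "(x0, x1) \<noteq> (0, 0)" "p = abs_proj1 (x0, x1)"
    "(y0, y1) \<noteq> (0, 0)" "q = abs_proj1 (y0, y1)"
    by (metis proj1_cases)
  show "affine_coord p = 0 \<or> affine_coord q = 0"
    if "bihom_zero (\<lambda>i j. of_bool (j = 0)) 0 1 p q"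
    using that pq by (auto simp: bihom_zero_abs affine_coord_abs bihom_def)
  show "(case (p, q) of (p, q) \<Rightarrow> affine_coord q) =
      bihom_ratio (\<lambda>i j. of_bool (j = 1)) (\<lambda>i j. of_bool (j = 0)) 0 1 p q"
    using pq by (simp add: bihom_ratio_abs affine_coord_abs bihom_def)
qed

lemma rational_on_decoupling_x:
  assumes "t \<noteq> 0"
  shows "rational_on (kernel_curve steps t) (\<lambda>(p, q). - (affine_coord p + 1 / affine_coord p))"
proof (rule rational_on_kernel_curve[OF assms])
  fix p q
  obtain x0 x1 y0 y1 where pq: "(x0, x1) \<noteq> (0, 0)" "p = abs_proj1 (x0, x1)"
    "(y0, y1) \<noteq> (0, 0)" "q = abs_proj1 (y0, y1)"
    by (metis proj1_cases)
  show "affine_coord p = 0 \<or> affine_coord q = 0"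
    if "bihom_zero (\<lambda>i j. of_bool (i = 1)) 2 0 p q"
    using that pq by (auto simp: bihom_zero_abs affine_coord_abs bihom_def numeral_2_eq_2)
  \<comment> \<open>Homogeneously this is \<open>- (x0\<^sup>2 + x1\<^sup>2) / (x0 * x1)\<close>;
    where the denominator vanishes, both sides are 0 by the convention for division.\<close>
  show "(case (p, q) of (p, q) \<Rightarrow> - (affine_coord p + 1 / affine_coord p)) =
      bihom_ratio (\<lambda>i j. - of_bool (i \<noteq> 1)) (\<lambda>i j. of_bool (i = 1)) 2 0 p q"
    using pq by (cases "x0 = 0"; cases "x1 = 0")
      (simp_all add: bihom_ratio_abs affine_coord_abs bihom_def numeral_2_eq_2 field_simps)
qed

lemma rational_on_decoupling_y:
  assumes "t \<noteq> 0"
  shows "rational_on (kernel_curve steps t) (\<lambda>(p, q). - (affine_coord q + 1 / affine_coord q))"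
proof (rule rational_on_kernel_curve[OF assms])
  fix p q
  obtain x0 x1 y0 y1 where pq: "(x0, x1) \<noteq> (0, 0)" "p = abs_proj1 (x0, x1)"
    "(y0, y1) \<noteq> (0, 0)" "q = abs_proj1 (y0, y1)"
    by (metis proj1_cases)
  show "affine_coord p = 0 \<or> affine_coord q = 0"
    if "bihom_zero (\<lambda>i j. of_bool (j = 1)) 0 2 p q"
    using that pq by (auto simp: bihom_zero_abs affine_coord_abs bihom_def numeral_2_eq_2)
  show "(case (p, q) of (p, q) \<Rightarrow> - (affine_coord q + 1 / affine_coord q)) =
      bihom_ratio (\<lambda>i j. - of_bool (j \<noteq> 1)) (\<lambda>i j. of_bool (j = 1)) 0 2 p q"
    using pq by (cases "y0 = 0"; cases "y1 = 0")
      (simp_all add: bihom_ratio_abs affine_coord_abs bihom_def numeral_2_eq_2 field_simps)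
qed

section \<open>Decoupling\<close>

lemma finite_affine_coord_kernel_curve:
  assumes "t \<noteq> 0"
  shows "finite {P \<in> kernel_curve steps t. affine_coord (fst P) = 0 \<or> affine_coord (snd P) = 0}"
proof (rule finite_subset[OF _ finite_UnI])
  show "finite {P \<in> kernel_curve steps t. fst P \<in> {p. affine_coord p = 0}}"
    by (rule finite_kernel_curve_fst[OF assms finite_affine_coord_eq_0])
  show "finite {P \<in> kernel_curve steps t. snd P \<in> {p. affine_coord p = 0}}"
    by (rule finite_kernel_curve_snd[OF assms finite_affine_coord_eq_0])
qed auto

text \<open>The points \<iota>1(P) and \<tau>(P) share their y-coordinate, while P and \<iota>1(P)
  share their x-coordinate. Subtracting the affine equation at \<iota>1(P) from that at \<tau>(P)
  cancels \<open>1/t\<close> and all terms in y alone.\<close>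

lemma b1_decoupling:
  assumes t: "t \<noteq> 0" and E: "E = kernel_curve steps t"
    and g: "g = germ E (\<lambda>(p, q). - (affine_coord p + 1 / affine_coord p))"
  shows "b1 steps t = pullback E (tau steps t) g \<ominus>\<^bsub>function_field E\<^esub> g"
proof -
  let ?x = "\<lambda>P. affine_coord (fst P)" and ?y = "\<lambda>P. affine_coord (snd P)"
  let ?Z = "{P \<in> E. ?x P = 0 \<or> ?y P = 0}"
  have fin: "finite ?Z"
    using finite_affine_coord_kernel_curve[OF t] by (simp add: E)
  have "b1 steps t = germ E (\<lambda>P. ?y (iota1 steps t P) * (?x (tau steps t P) - ?x P))"
    unfolding b1_def Let_def coord_x_def coord_y_def E[symmetric]
    using t rational_on_coord_x[OF t]
    by (simp add: E pullback_iota1 pullback_tau germ_minus germ_mult)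
       (simp add: case_prod_beta comp_def)
  also have "\<dots> = germ E (\<lambda>P. - (?x (tau steps t P) + 1 / ?x (tau steps t P)) -
      - (?x P + 1 / ?x P))"
  proof (rule germ_eqI)
    \<comment> \<open>The affine equation is used at \<iota>1(P) and \<tau>(P), so both preimages of
      the bad set \<open>?Z\<close> are removed.\<close>
    show "finite ({P \<in> E. iota1 steps t P \<in> ?Z} \<union> {P \<in> E. tau steps t P \<in> ?Z})"
      using finite_vimage_iota1[OF t fin] finite_vimage_tau[OF t fin]
      by (simp only: E finite_Un)
    fix P assume P: "P \<in> E" "P \<notin> {P \<in> E. iota1 steps t P \<in> ?Z} \<union> {P \<in> E. tau steps t P \<in> ?Z}"
    have curve: "?x Q * ?y Q = 1 / complex_of_real t - (?x Q + 1 / ?x Q) - (?y Q + 1 / ?y Q)"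
      if "Q \<in> E" "Q \<notin> ?Z" for Q
      using on_kernel_curve_affine[OF t, of "fst Q" "snd Q"] that
      by (auto simp: E kernel_curve_def)
    show "?y (iota1 steps t P) * (?x (tau steps t P) - ?x P) =
        - (?x (tau steps t P) + 1 / ?x (tau steps t P)) - - (?x P + 1 / ?x P)"
      using curve[of "iota1 steps t P"] curve[of "tau steps t P"] P
        iota1[OF t, of P] tau[OF t, of P]
      by (simp add: E right_diff_distrib mult.commute[of "?y (iota1 steps t P)"])
  qed
  also have "\<dots> = pullback E (tau steps t) g \<ominus>\<^bsub>function_field E\<^esub> g"
    using t rational_on_decoupling_x[OF t] unfolding g
    by (simp add: E pullback_tau germ_minus) (simp add: case_prod_beta comp_def)
  finally show ?thesis .
qed

text \<open>Here the affine equations at P and \<iota>1(P) are subtracted, which cancels the terms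
  in x alone; y at \<iota>1(P) then equals y at \<tau>(P).\<close>

lemma b2_decoupling:
  assumes t: "t \<noteq> 0" and E: "E = kernel_curve steps t"
    and g: "g = germ E (\<lambda>(p, q). - (affine_coord q + 1 / affine_coord q))"
  shows "b2 steps t = pullback E (tau steps t) g \<ominus>\<^bsub>function_field E\<^esub> g"
proof -
  let ?x = "\<lambda>P. affine_coord (fst P)" and ?y = "\<lambda>P. affine_coord (snd P)"
  let ?Z = "{P \<in> E. ?x P = 0 \<or> ?y P = 0}"
  have fin: "finite ?Z"
    using finite_affine_coord_kernel_curve[OF t] by (simp add: E)
  have "b2 steps t = germ E (\<lambda>P. ?x P * (?y (iota1 steps t P) - ?y P))"
    unfolding b2_def Let_def coord_x_def coord_y_def E[symmetric]
    using t rational_on_coord_y[OF t]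
    by (simp add: E pullback_iota1 germ_minus germ_mult) (simp add: case_prod_beta comp_def)
  also have "\<dots> = germ E (\<lambda>P. - (?y (tau steps t P) + 1 / ?y (tau steps t P)) -
      - (?y P + 1 / ?y P))"
  proof (rule germ_eqI)
    show "finite (?Z \<union> {P \<in> E. iota1 steps t P \<in> ?Z})"
      using finite_vimage_iota1[OF t fin] fin by (simp only: E finite_Un)
    fix P assume P: "P \<in> E" "P \<notin> ?Z \<union> {P \<in> E. iota1 steps t P \<in> ?Z}"
    have curve: "?x Q * ?y Q = 1 / complex_of_real t - (?x Q + 1 / ?x Q) - (?y Q + 1 / ?y Q)"
      if "Q \<in> E" "Q \<notin> ?Z" for Q
      using on_kernel_curve_affine[OF t, of "fst Q" "snd Q"] that
      by (auto simp: E kernel_curve_def)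
    show "?x P * (?y (iota1 steps t P) - ?y P) =
        - (?y (tau steps t P) + 1 / ?y (tau steps t P)) - - (?y P + 1 / ?y P)"
      using curve[of P] curve[of "iota1 steps t P"] P iota1[OF t, of P] tau[OF t, of P]
      by (simp add: E right_diff_distrib)
  qed
  also have "\<dots> = pullback E (tau steps t) g \<ominus>\<^bsub>function_field E\<^esub> g"
    using t rational_on_decoupling_y[OF t] unfolding g
    by (simp add: E pullback_tau germ_minus) (simp add: case_prod_beta comp_def)
  finally show ?thesis .
qed

lemma finsum_function_field_empty: "(\<Oplus>\<^bsub>function_field E\<^esub>k\<in>{}. A k) = germ E (\<lambda>_. 0)"
proof -
  \<comment> \<open>The fold behind an empty sum returns its start value when that value lies in the
    carrier, so zero has to be rational.\<close>
  have "rational_on E (\<lambda>_. 0)"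
    unfolding rational_on_def
  proof (intro exI conjI)
    show "finite {(p, q) \<in> E. bihom_zero (\<lambda>_ _. 1) 0 0 p q}"
      by (simp add: bihom_zero.rep_eq bihom_def case_prod_beta)
    show "finite {(p, q) \<in> E. 0 \<noteq> bihom_ratio (\<lambda>_ _. 0) (\<lambda>_ _. 1) 0 0 p q}"
      by (simp add: bihom_ratio.rep_eq bihom_def case_prod_beta)
  qed
  then show ?thesis
    by (simp add: finsum_def finprod_def function_field_def)
qed

theorem theorem6p8:
  fixes D :: "(int \<times> int) set" and t :: real
    and E :: "point set" and K :: "(point \<Rightarrow> complex) set ring"
    and \<Omega> :: "((point \<Rightarrow> complex) set \<Rightarrow> (point \<Rightarrow> complex) set) set"
    and \<delta> :: "(point \<Rightarrow> complex) set \<Rightarrow> (point \<Rightarrow> complex) set"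
  assumes D: "D = {(0, 1), (1, 1), (-1, 0), (1, 0), (0, -1)}"
    and t: "0 < t" "t < 1 / real (card D)" "\<not> algebraic t"
    and G: "infinite (walk_group D t)"
    and E: "E = kernel_curve D t"
    and K: "K = function_field E"
    and \<Omega>: "regular_differential E \<Omega>" "\<Omega> \<noteq> \<zero>\<^bsub>differentials E\<^esub>"
    and \<delta>: "derivation K (range (const_fun E)) \<delta>"
      "\<forall>f \<in> carrier K. differential E f = \<delta> f \<odot>\<^bsub>differentials E\<^esub> \<Omega>"
  shows "\<forall>b \<in> {b1 D t, b2 D t}. \<exists>(n::nat) (c :: nat \<Rightarrow> complex). \<exists>g \<in> carrier K.
    (\<delta> ^^ n) b \<oplus>\<^bsub>K\<^esub> (\<Oplus>\<^bsub>K\<^esub>k\<in>{..<n}. const_fun E (c k) \<otimes>\<^bsub>K\<^esub> (\<delta> ^^ k) b)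
      = pullback E (tau D t) g \<ominus>\<^bsub>K\<^esub> g"
proof -
  have t0: "t \<noteq> 0"
    using t(1) by simp
  have Ds: "D = steps"
    by (simp add: D steps_def)
  have E': "E = kernel_curve steps t"
    by (simp add: E Ds)
  \<comment> \<open>For \<open>n = 0\<close> the left side is \<open>b\<close> plus an empty sum, so
    it suffices that \<open>b\<close> itself is a difference \<tau>(g) - g.\<close>
  have coboundary: "\<exists>(n::nat) (c :: nat \<Rightarrow> complex). \<exists>g \<in> carrier K.
      (\<delta> ^^ n) b \<oplus>\<^bsub>K\<^esub> (\<Oplus>\<^bsub>K\<^esub>k\<in>{..<n}. const_fun E (c k) \<otimes>\<^bsub>K\<^esub> (\<delta> ^^ k) b)
        = pullback E (tau D t) g \<ominus>\<^bsub>K\<^esub> g"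
    if b: "b = pullback E (tau D t) g \<ominus>\<^bsub>K\<^esub> g" and g: "g = germ E f" "rational_on E f" for b g f
  proof (intro exI bexI)
    \<comment> \<open>Adding the zero of the field is evaluated on germs, so \<open>b\<close> is
      first written as one. The coefficient witness \<open>undefined\<close> is a placeholder, since
      the index set is empty.\<close>
    have "b = germ E (\<lambda>P. (f \<circ> tau D t) P - f P)"
      unfolding b g(1) K germ_minus[OF g(2), symmetric]
      by (simp add: pullback_tau[OF t0] E' Ds comp_def)
    then show "(\<delta> ^^ 0) b \<oplus>\<^bsub>K\<^esub> (\<Oplus>\<^bsub>K\<^esub>k\<in>{..<0}. const_fun E (undefined k) \<otimes>\<^bsub>K\<^esub> (\<delta> ^^ k) b)
        = pullback E (tau D t) g \<ominus>\<^bsub>K\<^esub> g"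
      unfolding b[symmetric] by (simp add: K finsum_function_field_empty germ_add)
    show "g \<in> carrier K"
      using g by (simp add: K germ_in_function_field)
  qed
  show ?thesis
    unfolding ball_simps Ds K
    using coboundary[OF _ refl rational_on_decoupling_x[OF t0, folded E']]
      coboundary[OF _ refl rational_on_decoupling_y[OF t0, folded E']]
      b1_decoupling[OF t0 E' refl] b2_decoupling[OF t0 E' refl]
    by (simp add: Ds K)
qed

end
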